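(* Let $n\ge 1$ be an integer and let $\mathcal{L}_n(x)$ be a generalized Fibonacci polynomial of Lucas type determined by $d(x)$ and $g(x)$. For $j=0,1,\dots,n-1$ let $\tau_j=2i\cos\frac{(2j+1)\pi}{2n}$, where $i=\sqrt{-1}$. If $t\in\mathbb{C}$ satisfies $g(t)\ne0$ and $d(t)/\sqrt{g(t)}=\tau_j$ for some $j\in\{0,1,\dots,n-1\}$, then $t$ is a root of $\mathcal{L}_n(x)$.
   Context: Given nonzero polynomials $d(x),g(x)\in\mathbb{Q}[x]$ with $\deg d>\deg g$, the generalized Fibonacci polynomials of Lucas type are $\mathcal{L}_0(x)=p_0$, $\mathcal{L}_1(x)=p_1(x)$, $\mathcal{L}_n(x)=d(x)\mathcal{L}_{n-1}(x)+g(x)\mathcal{L}_{n-2}(x)$ for $n\ge2$, where $p_0\in\{\pm1,\pm2\}$, $\alpha=2/p_0$, and $p_1(x)\in\mathbb{Q}[x]$ satisfies $d(x)=\alpha p_1(x)$. $\sqrt{g(t)}$ denotes a complex square root of $g(t)$. *)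

theory Defs
  imports Complex_Main "HOL-Computational_Algebra.Polynomial"
begin

text \<open>
  \<open>lucas_type_gfp d g L\<close> says that \<open>L\<close> is a sequence of generalized Fibonacci polynomials of
  Lucas type determined by \<open>d\<close> and \<open>g\<close>.  The number \<open>\<alpha> = 2 / p0\<close> is written out.
\<close>

definition lucas_type_gfp :: "rat poly \<Rightarrow> rat poly \<Rightarrow> (nat \<Rightarrow> rat poly) \<Rightarrow> bool" where
  "lucas_type_gfp d g L \<longleftrightarrow>
     d \<noteq> 0 \<and> g \<noteq> 0 \<and> degree d > degree g \<and>
     (\<exists>p0 p1. p0 \<in> {1, -1, 2, -2} \<and> d = smult (2 / p0) p1 \<and>
              L 0 = [:p0:] \<and> L 1 = p1) \<and>
     (\<forall>n\<ge>2. L n = d * L (n - 1) + g * L (n - 2))"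

definition cpoly :: "rat poly \<Rightarrow> complex \<Rightarrow> complex" where
  "cpoly p t = poly (map_poly of_rat p) t"

definition tau :: "nat \<Rightarrow> nat \<Rightarrow> complex" where
  "tau n j = 2 * \<i> * complex_of_real (cos ((2 * real j + 1) * pi / (2 * real n)))"

end

(* With d(t) = 2 i s cos \<theta> and g(t) = s^2, the recurrence becomes the Chebyshev recurrence, so
   L_n(t) = p0 (i s)^n cos (n \<theta>), and cos (n \<theta>) = 0 for \<theta> = (2 j + 1) \<pi> / (2 n). *)

theory Submission
  imports Defs
begin

text \<open>Since \<open>of_rat\<close> is a ring homomorphism, so is evaluation at t; this and the
  next three lemmas turn the recurrence of polynomials into one of complex numbers.\<close>

lemma cpoly_const: "cpoly [:c:] t = of_rat c"
  by (simp add: cpoly_def map_poly_pCons)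

lemma cpoly_add: "cpoly (p + q) t = cpoly p t + cpoly q t"
proof -
  have "map_poly of_rat (p + q) = map_poly of_rat p + (map_poly of_rat q :: complex poly)"
    by (rule poly_eqI) (simp add: coeff_map_poly of_rat_add)
  then show ?thesis by (simp add: cpoly_def)
qed

lemma cpoly_mult: "cpoly (p * q) t = cpoly p t * cpoly q t"
proof -
  have "map_poly of_rat (p * q) = map_poly of_rat p * (map_poly of_rat q :: complex poly)"
    by (rule poly_eqI) (simp add: coeff_map_poly coeff_mult of_rat_sum of_rat_mult)
  then show ?thesis by (simp add: cpoly_def)
qed

lemma cpoly_smult: "cpoly (smult c p) t = of_rat c * cpoly p t"
  using cpoly_mult[of "[:c:]" p t] by (simp add: cpoly_const)

lemma cos_add_two_mult:
  fixes x :: real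
  shows "cos (real (k + 2) * x) = 2 * cos x * cos (real (k + 1) * x) - cos (real k * x)"
proof -
  have "cos (real (k + 2) * x) = cos (real (k + 1) * x + x)"
    and "cos (real k * x) = cos (real (k + 1) * x - x)"
    by (simp_all add: algebra_simps)
  then show ?thesis by (simp add: cos_add cos_diff)
qed

text \<open>Both sides obey the same second-order recurrence and agree at 0 and 1. For c = z = 1 it
  defines T_k(cos \<theta>), with T_k the Chebyshev polynomial of the first kind; z rescales the
  k-th term by z^k.\<close>

lemma chebyshev_recurrence:
  fixes a :: "nat \<Rightarrow> complex" and \<theta> :: real
  assumes "a 0 = c" "a 1 = c * z * of_real (cos \<theta>)"
    and rec: "\<And>k. a (k + 2) = 2 * z * of_real (cos \<theta>) * a (k + 1) - z ^ 2 * a k"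
  shows "a k = c * z ^ k * of_real (cos (real k * \<theta>))"
proof (induction k rule: induct_nat_012)
  case 0
  then show ?case using assms(1) by simp
next
  case 1
  then show ?case using assms(2) by simp
next
  case (ge2 k)
  have "a (k + 2) = c * z ^ (k + 2) *
      of_real (2 * cos \<theta> * cos (real (k + 1) * \<theta>) - cos (real k * \<theta>))"
    \<comment> \<open>The factors z and z^2 of the recurrence raise both induction hypotheses to the
      common power z^(k+2).\<close>
    unfolding rec using ge2 by (simp add: algebra_simps power2_eq_square)
  also have "\<dots> = c * z ^ (k + 2) * of_real (cos (real (k + 2) * \<theta>))"
    by (simp only: cos_add_two_mult)
  finally show ?case by simp
qed

text \<open>The choice z = \<i> s works because z^2 = -g(t) supplies the minus sign of the Chebyshev
  recurrence, while d(t) = 2 z cos \<theta>.\<close>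

lemma cpoly_lucas_type_gfp:
  assumes L: "lucas_type_gfp d g L"
    and g: "cpoly g t = s ^ 2"
    and d: "cpoly d t = 2 * \<i> * s * of_real (cos \<theta>)"
  shows "cpoly (L k) t = cpoly (L 0) t * (\<i> * s) ^ k * of_real (cos (real k * \<theta>))"
proof (rule chebyshev_recurrence)
  obtain p0 p1 where "p0 \<in> {1, -1, 2, -2}" and "d = smult (2 / p0) p1"
    and L0: "L 0 = [:p0:]" and "L 1 = p1"
    using L unfolding lucas_type_gfp_def by blast
  \<comment> \<open>As p0 is nonzero, the relation between d and p1 can be inverted. The factor 1/2
    cancels the 2 in d(t), which gives the initial value of the first kind.\<close>
  then have "L 1 = smult (p0 / 2) d" by auto
  then have "cpoly (L 1) t = of_rat (p0 / 2) * cpoly d t" by (simp add: cpoly_smult)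
  then show "cpoly (L 1) t = cpoly (L 0) t * (\<i> * s) * of_real (cos \<theta>)"
    by (simp add: d L0 cpoly_const of_rat_divide)
next
  fix k
  have "L (k + 2) = d * L (k + 1) + g * L k"
    using L unfolding lucas_type_gfp_def by (auto dest: spec[of _ "k + 2"])
  then show "cpoly (L (k + 2)) t
      = 2 * (\<i> * s) * of_real (cos \<theta>) * cpoly (L (k + 1)) t - (\<i> * s) ^ 2 * cpoly (L k) t"
    by (simp add: cpoly_add cpoly_mult g d power_mult_distrib)
qed simp

theorem theorem4p4:
  fixes n :: nat and d g :: "rat poly" and L :: "nat \<Rightarrow> rat poly" and t s :: complex
  assumes "n \<ge> 1"
    and "lucas_type_gfp d g L"
    and "cpoly g t \<noteq> 0"
    and "s ^ 2 = cpoly g t"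
    and "\<exists>j\<in>{0..n - 1}. cpoly d t / s = tau n j"
  shows "cpoly (L n) t = 0"
proof -
  obtain j where j: "cpoly d t / s = tau n j" using assms(5) by blast
  define \<theta> where "\<theta> = (2 * real j + 1) * pi / (2 * real n)"
  \<comment> \<open>Needed to clear the denominator s in the equation for
    \<open>tau n j\<close>.\<close>
  have "s \<noteq> 0" using assms(3,4) by auto
  then have "cpoly d t = 2 * \<i> * s * of_real (cos \<theta>)"
    using j by (simp add: tau_def \<theta>_def field_simps)
  then have "cpoly (L n) t = cpoly (L 0) t * (\<i> * s) ^ n * of_real (cos (real n * \<theta>))"
    using assms(2,4) by (intro cpoly_lucas_type_gfp) auto
  \<comment> \<open>An odd multiple of \<pi>/2: in the addition formula both products vanish, by
    cos(\<pi>/2) = 0 and sin(j \<pi>) = 0.\<close>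
  moreover have "real n * \<theta> = real j * pi + pi / 2"
    using assms(1) by (simp add: \<theta>_def field_simps)
  then have "cos (real n * \<theta>) = 0" by (simp add: cos_add)
  ultimately show ?thesis by simp
qed

end
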